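(* Let $t\in\{0,\dots,d\}$, let $\mathcal{T}\subseteq[d]$ be sampled uniformly at random among subsets of cardinality $d-t$, and let $S_3^{\mathcal{T}}$ be the associated random candidate support $$S_3^{\mathcal{T}}:=\big\{\bm{y}\in\mathbb{R}^d:\ \exists\,\bm{x}\in\hat U\text{ with }\bm{y}_{\mathcal{T}}=\bm{x}_{\mathcal{T}},\ \text{and } y_\ell\in U_\ell\text{ for every }\ell\notin\mathcal{T}\big\}.$$ Then $$\mathbb{E}_{\mathcal{T}}\big[v_I(S_3^{\mathcal{T}})\big]\le\Big(1+\frac{d-t}{d}\Big)v_I^* .$$
   Context: Notation: $[k]=\{1,\dots,k\}$. For $i\in[k]$, $\mathbb{P}_i=\sum_{j\in[|\Xi_i|]}\hat p_{ij}\delta_{\hat{\bm{x}}_{ij}}$ is a probability measure supported on a nonempty finite set $\Xi_i=\{\hat{\bm{x}}_{ij}\}_j\subseteq\mathbb{R}^d$ with $|\Xi_i|\le n$ ($d\ge1$). Weights satisfy $\lambda_i\ge0$ and $\sum_{i\in[k]}\lambda_i=1$. The type-1 barycenter value is $v_I^*=\inf_{\mathbb{P}}\sum_{i\in[k]}\lambda_iW_1(\mathbb{P},\mathbb{P}_i)$, the infimum over Borel probability measures on $\mathbb{R}^d$ with finite first moment, where $W_1(\mathbb{P},\mathbb{Q})=\inf_{\Pi}\int\|\bm{x}-\bm{y}\|_1\,d\Pi(\bm{x},\bm{y})$ over couplings $\Pi$ of $\mathbb{P},\mathbb{Q}$ (note the $\ell_1$ norm). For a nonempty finite set $S\subseteq\mathbb{R}^d$,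 $v_I(S)$ is the value of the type-1 restricted multi-marginal optimal transport problem: the minimum of $\sum_{\vec{\bm{j}}}C^{(1)}_{\vec{\bm{j}}}(S)\Pi_{\vec{\bm{j}}}$ over nonnegative tensors $\bm\Pi$ indexed by $\vec{\bm{j}}=(j_1,\dots,j_k)\in\prod_{i\in[k]}[|\Xi_i|]$ whose $i$-th marginal is $(\hat p_{ij})_j$ for every $i\in[k]$, where $C^{(1)}_{\vec{\bm{j}}}(S)=\min_{\bm{w}\in S}\sum_{i\in[k]}\lambda_i\|\bm{w}-\hat{\bm{x}}_{i,j_i}\|_1$. $\hat U:=\bigcup_{i\in[k]}\Xi_i$; $U_\ell:=\{x_\ell:\bm{x}\in\hat U\}$ for $\ell\in[d]$; $\bm{x}_{\mathcal{T}}$ is the subvector of $\bm{x}$ with coordinates in $\mathcal{T}$. *)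

theory Defs
  imports "HOL-Probability.Probability"
begin

definition l1_norm :: "real ^ 'd \<Rightarrow> real" where
  "l1_norm x = (\<Sum>l\<in>UNIV. \<bar>x $ l\<bar>)"

(* The finitely supported measure "sum over j in [m] of p j times the Dirac measure at x j";
   see emeasure_discrete_measure below. *)
definition discrete_measure :: "nat \<Rightarrow> (nat \<Rightarrow> real) \<Rightarrow> (nat \<Rightarrow> real ^ 'd) \<Rightarrow> (real ^ 'd) measure" where
  "discrete_measure m p x = distr (point_measure {1..m} (\<lambda>j. ennreal (p j))) borel x"

lemma emeasure_discrete_measure:
  fixes x :: "nat \<Rightarrow> real ^ 'd"
  assumes "A \<in> sets borel"
  shows "emeasure (discrete_measure m p x) A
    = (\<Sum>j\<in>{1..m}. ennreal (p j) * emeasure (return borel (x j)) A)"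
proof -
  have "emeasure (discrete_measure m p x) A
      = emeasure (point_measure {1..m} (\<lambda>j. ennreal (p j))) (x -` A \<inter> {1..m})"
    unfolding discrete_measure_def
    by (subst emeasure_distr) (use assms in \<open>auto simp: space_point_measure\<close>)
  also have "\<dots> = (\<Sum>j\<in>x -` A \<inter> {1..m}. ennreal (p j))"
    by (rule emeasure_point_measure_finite) auto
  also have "\<dots> = (\<Sum>j\<in>{1..m}. ennreal (p j) * indicator A (x j))"
    by (rule sum.mono_neutral_cong_left) (auto simp: indicator_def)
  finally show ?thesis
    using assms by simp
qed

definition P1_measures :: "(real ^ 'd) measure set" where
  "P1_measures = {P. prob_space P \<and> sets P = sets borel \<and> integrable P l1_norm}"

definition couplings ::
  "(real ^ 'd) measure \<Rightarrow> (real ^ 'd) measure \<Rightarrow> ((real ^ 'd) \<times> (real ^ 'd)) measure set" where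
  "couplings P Q = {R. sets R = sets (borel \<Otimes>\<^sub>M borel) \<and> distr R borel fst = P \<and> distr R borel snd = Q}"

(* Meant for P and Q in P1_measures only: there the set of couplings is nonempty (it contains the
   product measure) and the cost is integrable with respect to every coupling, so neither the
   real-valued Inf nor the Bochner integral takes a default value. *)
definition W1 :: "(real ^ 'd) measure \<Rightarrow> (real ^ 'd) measure \<Rightarrow> real" where
  "W1 P Q = (INF R\<in>couplings P Q. \<integral>z. l1_norm (fst z - snd z) \<partial>R)"

definition barycenter_value ::
  "nat \<Rightarrow> (nat \<Rightarrow> real) \<Rightarrow> (nat \<Rightarrow> nat) \<Rightarrow> (nat \<Rightarrow> nat \<Rightarrow> real) \<Rightarrow> (nat \<Rightarrow> nat \<Rightarrow> real ^ 'd) \<Rightarrow> real" where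
  "barycenter_value k lam m p xhat =
    (INF P\<in>P1_measures. \<Sum>i\<in>{1..k}. lam i * W1 P (discrete_measure (m i) (p i) (xhat i)))"

definition multi_indices :: "nat \<Rightarrow> (nat \<Rightarrow> nat) \<Rightarrow> (nat \<Rightarrow> nat) set" where
  "multi_indices k m = (\<Pi>\<^sub>E i\<in>{1..k}. {1..m i})"

(* Tensors are functions on multi-indices; values off multi_indices k m are irrelevant. *)
definition feasible_tensors ::
  "nat \<Rightarrow> (nat \<Rightarrow> nat) \<Rightarrow> (nat \<Rightarrow> nat \<Rightarrow> real) \<Rightarrow> ((nat \<Rightarrow> nat) \<Rightarrow> real) set" where
  "feasible_tensors k m p = {T.
     (\<forall>js\<in>multi_indices k m. 0 \<le> T js) \<and>
     (\<forall>i\<in>{1..k}. \<forall>j\<in>{1..m i}. (\<Sum>js\<in>{js\<in>multi_indices k m. js i = j}. T js) = p i j)}"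

(* Min is the genuine minimum for nonempty finite S only. *)
definition restricted_cost ::
  "nat \<Rightarrow> (nat \<Rightarrow> real) \<Rightarrow> (nat \<Rightarrow> nat \<Rightarrow> real ^ 'd) \<Rightarrow> (real ^ 'd) set \<Rightarrow> (nat \<Rightarrow> nat) \<Rightarrow> real" where
  "restricted_cost k lam xhat S js =
    Min ((\<lambda>w. \<Sum>i\<in>{1..k}. lam i * l1_norm (w - xhat i (js i))) ` S)"

(* The infimum is attained: the objective is linear and the feasible tensors (restricted to
   multi_indices k m) form a nonempty compact polytope. *)
definition restricted_value ::
  "nat \<Rightarrow> (nat \<Rightarrow> real) \<Rightarrow> (nat \<Rightarrow> nat) \<Rightarrow> (nat \<Rightarrow> nat \<Rightarrow> real) \<Rightarrow> (nat \<Rightarrow> nat \<Rightarrow> real ^ 'd)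
    \<Rightarrow> (real ^ 'd) set \<Rightarrow> real" where
  "restricted_value k lam m p xhat S =
    (INF T\<in>feasible_tensors k m p. \<Sum>js\<in>multi_indices k m. restricted_cost k lam xhat S js * T js)"

definition support_union :: "nat \<Rightarrow> (nat \<Rightarrow> nat) \<Rightarrow> (nat \<Rightarrow> nat \<Rightarrow> real ^ 'd) \<Rightarrow> (real ^ 'd) set" where
  "support_union k m xhat = (\<Union>i\<in>{1..k}. xhat i ` {1..m i})"

definition coord_values :: "nat \<Rightarrow> (nat \<Rightarrow> nat) \<Rightarrow> (nat \<Rightarrow> nat \<Rightarrow> real ^ 'd) \<Rightarrow> 'd \<Rightarrow> real set" where
  "coord_values k m xhat l = {x $ l | x. x \<in> support_union k m xhat}"

definition S3 :: "nat \<Rightarrow> (nat \<Rightarrow> nat) \<Rightarrow> (nat \<Rightarrow> nat \<Rightarrow> real ^ 'd) \<Rightarrow> 'd set \<Rightarrow> (real ^ 'd) set" where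
  "S3 k m xhat T = {y. (\<exists>x\<in>support_union k m xhat. \<forall>l\<in>T. y $ l = x $ l) \<and>
                       (\<forall>l. l \<notin> T \<longrightarrow> y $ l \<in> coord_values k m xhat l)}"

end

(* Fix a measure P and couplings R i of P with the i-th given measure. Disintegrating R i along P
   gives weights f i j y, and the tensor with entries \<open>\<integral>y. (\<Prod>i. f i (js i) y) \<partial>P\<close> is feasible.
   Its cost with an arbitrary centre is the total cost of the couplings, so it suffices to compare the
   average of the restricted cost over T with the unrestricted cost for each multi-index js separately.
   There the unrestricted cost splits over coordinates. The candidate support contains the points that
   agree with some xhat r (js r) on T and with a weighted median off T; averaging them over r with
   weights lam r at most doubles the cost of the coordinates in T, and each coordinate lies in T with
   probability (d - t) / d. *)
theory Submission
  imports Defs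
begin

section \<open>Weighted medians and uniformly distributed subsets\<close>

lemma finite_obtains_greatest:
  fixes a :: "'i \<Rightarrow> real"
  assumes "finite I" "I \<noteq> {}"
  obtains q where "q \<in> I" "\<And>i. i \<in> I \<Longrightarrow> a i \<le> a q"
proof -
  have "Max (a ` I) \<in> a ` I"
    using assms by (intro Max_in) auto
  then obtain q where "q \<in> I" "a q = Max (a ` I)"
    by (metis imageE)
  moreover have "a i \<le> Max (a ` I)" if "i \<in> I" for i
    using assms that by (intro Max_ge) auto
  ultimately show ?thesis
    using that[of q] by simp
qed

text \<open>Take for \<open>a r\<close> the smallest value whose cumulative weight reaches half of
  the total. Moving away from \<open>a r\<close> to any \<open>u\<close> raises the distance to
  points carrying at least half of the weight by \<open>\<bar>u - a r\<bar>\<close>, and lowers the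
  others by at most that amount. The minimiser is one of the values \<open>a i\<close>, which later
  keeps it inside the candidate support.\<close>

lemma weighted_median:
  fixes a w :: "'i \<Rightarrow> real"
  assumes "finite I" "I \<noteq> {}" "\<And>i. i \<in> I \<Longrightarrow> 0 \<le> w i"
  obtains r where "r \<in> I" "\<And>u. (\<Sum>i\<in>I. w i * \<bar>a r - a i\<bar>) \<le> (\<Sum>i\<in>I. w i * \<bar>u - a i\<bar>)"
proof -
  define W where "W = sum w I"
  define G where "G = {r \<in> I. W / 2 \<le> sum w {i \<in> I. a i \<le> a r}}"
  have W0: "0 \<le> W"
    unfolding W_def using assms by (intro sum_nonneg) auto
  obtain q where q: "q \<in> I" "\<And>i. i \<in> I \<Longrightarrow> a i \<le> a q"
    using finite_obtains_greatest[OF assms(1,2), of a] by blast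
  have "{i \<in> I. a i \<le> a q} = I"
    using q by auto
  then have "q \<in> G"
    using q W0 by (simp add: G_def W_def)
  moreover have "finite G"
    using assms by (simp add: G_def)
  ultimately obtain r where r: "r \<in> G" "\<And>i. i \<in> G \<Longrightarrow> a r \<le> a i"
    using finite_obtains_greatest[of G "\<lambda>i. - a i"] by (metis empty_iff neg_le_iff_le)
  have rI: "r \<in> I" and up: "W / 2 \<le> sum w {i \<in> I. a i \<le> a r}"
    using r by (auto simp: G_def)
  \<comment> \<open>If some value lies below \<open>a r\<close>, let \<open>a s\<close> be the
    largest such value. By minimality \<open>s\<close> is not in \<open>G\<close>, and the points
    strictly below \<open>a r\<close> are exactly those up to \<open>a s\<close>, so their weight is
    less than half.\<close>
  have low: "sum w {i \<in> I. a i < a r} \<le> W / 2"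
  proof (cases "{i \<in> I. a i < a r} = {}")
    case True
    show ?thesis unfolding True using W0 by simp
  next
    case False
    have fin: "finite {i \<in> I. a i < a r}"
      using assms(1) by simp
    obtain s where "s \<in> {i \<in> I. a i < a r}"
      "\<And>i. i \<in> {i \<in> I. a i < a r} \<Longrightarrow> a i \<le> a s"
      using finite_obtains_greatest[OF fin False, of a] by blast
    then have s: "s \<in> I" "a s < a r" "\<And>i. i \<in> I \<Longrightarrow> a i < a r \<Longrightarrow> a i \<le> a s"
      by blast+
    then have "s \<notin> G"
      using r(2)[of s] by linarith
    moreover have "{i \<in> I. a i < a r} = {i \<in> I. a i \<le> a s}"
      using s(2,3) by (blast intro: order.strict_trans1)
    ultimately show ?thesis
      using s by (simp add: G_def)
  qed
  have split: "W = sum w {i \<in> I. Q i} + sum w {i \<in> I. \<not> Q i}" for Q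
    unfolding W_def using assms(1)
    by (subst sum.union_disjoint[symmetric]) (auto intro!: sum.cong)
  have signed: "(\<Sum>i\<in>I. w i * (if Q i then c else - c))
      = c * (sum w {i \<in> I. Q i} - sum w {i \<in> I. \<not> Q i})" for c :: real and Q
  proof -
    have "(\<Sum>i\<in>I. w i * (if Q i then c else - c)) = (\<Sum>i\<in>I. if Q i then w i * c else - (w i * c))"
      by (intro sum.cong) auto
    also have "\<dots> = (\<Sum>i | i \<in> I \<and> Q i. w i * c) + (\<Sum>i | i \<in> I \<and> \<not> Q i. - (w i * c))"
      unfolding sum.If_cases[OF assms(1)] by (intro arg_cong2[where f = "(+)"] sum.cong) auto
    finally show ?thesis
      by (simp add: sum_negf sum_distrib_left right_diff_distrib mult.commute)
  qed
  have "(\<Sum>i\<in>I. w i * \<bar>a r - a i\<bar>) \<le> (\<Sum>i\<in>I. w i * \<bar>u - a i\<bar>)" for u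
  proof -
    \<comment> \<open>\<open>Q\<close> marks the points from which the move from \<open>a r\<close>
      to \<open>u\<close> leads away. Points tied with \<open>a r\<close> belong to \<open>Q\<close>
      in both cases, hence the non-strict comparison in one case and the strict one in the
      other.\<close>
    obtain Q where Q: "\<And>i. \<bar>a r - a i\<bar> + (if Q i then \<bar>u - a r\<bar> else - \<bar>u - a r\<bar>) \<le> \<bar>u - a i\<bar>"
      and bal: "sum w {i \<in> I. \<not> Q i} \<le> sum w {i \<in> I. Q i}"
    proof (cases "a r \<le> u")
      case True
      show ?thesis
        by (rule that[of "\<lambda>i. a i \<le> a r"]) (use True split[of "\<lambda>i. a i \<le> a r"] up in auto)
    next
      case False
      show ?thesis
        by (rule that[of "\<lambda>i. \<not> a i < a r"]) (use False split[of "\<lambda>i. a i < a r"] low in auto)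
    qed
    have "(\<Sum>i\<in>I. w i * \<bar>a r - a i\<bar>)
        \<le> (\<Sum>i\<in>I. w i * (\<bar>a r - a i\<bar> + (if Q i then \<bar>u - a r\<bar> else - \<bar>u - a r\<bar>)))"
      using bal signed[of Q "\<bar>u - a r\<bar>"]
      by (simp add: distrib_left sum.distrib)
    also have "\<dots> \<le> (\<Sum>i\<in>I. w i * \<bar>u - a i\<bar>)"
      by (intro sum_mono mult_left_mono Q assms)
    finally show ?thesis .
  qed
  with rI show ?thesis
    by (rule that)
qed

text \<open>By exchanging the sums, each \<open>c l\<close> is counted once for every set of size
  \<open>s\<close> containing \<open>l\<close>, and by symmetry this is the same fraction of all
  such sets for every \<open>l\<close>.\<close>

lemma sum_uniform_subsets:
  fixes c :: "'a::finite \<Rightarrow> real"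
  assumes "s \<le> CARD('a)"
  shows "(\<Sum>T | card T = s. \<Sum>l\<in>T. c l)
    = real s / real CARD('a) * real (CARD('a) choose s) * sum c UNIV"
proof -
  let ?F = "{T :: 'a set. card T = s}"
  have cF: "card ?F = CARD('a) choose s"
    using n_subsets[of "UNIV :: 'a set" s] by simp
  have avoid: "card {T \<in> ?F. l \<notin> T} = (CARD('a) - 1) choose s" for l
  proof -
    have "{T \<in> ?F. l \<notin> T} = {T. T \<subseteq> UNIV - {l} \<and> card T = s}"
      by auto
    then show ?thesis
      by (simp add: n_subsets)
  qed
  \<comment> \<open>The sets containing \<open>l\<close> are counted through those avoiding it, with
    the absorption identity for binomials. No \<open>s - 1\<close> occurs, so \<open>s = 0\<close>
    needs no case of its own.\<close>
  have hit: "real (card {T \<in> ?F. l \<in> T}) = real s / real CARD('a) * real (CARD('a) choose s)" for l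
  proof -
    have "{T \<in> ?F. l \<in> T} = ?F - {T \<in> ?F. l \<notin> T}"
      by auto
    moreover have "card {T \<in> ?F. l \<notin> T} \<le> card ?F"
      by (intro card_mono) auto
    ultimately have "real (card {T \<in> ?F. l \<in> T})
        = real (CARD('a) choose s) - real ((CARD('a) - 1) choose s)"
      by (simp only: card_Diff_subset[OF finite Collect_restrict] of_nat_diff avoid cF)
    moreover have "(real CARD('a) - real s) * real (CARD('a) choose s)
        = real CARD('a) * real ((CARD('a) - 1) choose s)"
      using binomial_absorb_comp[of "CARD('a)" s] assms
      by (metis of_nat_diff of_nat_mult)
    ultimately have "real CARD('a) * real (card {T \<in> ?F. l \<in> T}) = real s * real (CARD('a) choose s)"
      by (simp only: right_diff_distrib left_diff_distrib)
    then have "real (card {T \<in> ?F. l \<in> T}) = real s * real (CARD('a) choose s) / real CARD('a)"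
      by (subst eq_divide_eq) (simp add: mult.commute)
    then show ?thesis
      by simp
  qed
  have "(\<Sum>T\<in>?F. \<Sum>l\<in>T. c l) = (\<Sum>T\<in>?F. \<Sum>l\<in>UNIV. if l \<in> T then c l else 0)"
    by (simp add: sum.If_cases)
  also have "\<dots> = (\<Sum>l\<in>UNIV. \<Sum>T\<in>?F. if l \<in> T then c l else 0)"
    by (rule sum.swap)
  also have "\<dots> = (\<Sum>l\<in>UNIV. real (card {T \<in> ?F. l \<in> T}) * c l)"
    by (simp add: sum.If_cases Int_def)
  finally show ?thesis
    unfolding hit by (simp add: sum_distrib_left)
qed

section \<open>The candidate support and its cost for a fixed multi-index\<close>

lemma l1_norm_nonneg: "0 \<le> l1_norm x"
  by (simp add: l1_norm_def sum_nonneg)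

lemma l1_norm_triangle: "l1_norm (x - y) \<le> l1_norm x + l1_norm y"
  unfolding l1_norm_def sum.distrib[symmetric] by (intro sum_mono) simp

lemma borel_measurable_l1_norm [measurable]: "l1_norm \<in> borel_measurable borel"
  unfolding l1_norm_def by measurable

lemma finite_coord_values: "finite (coord_values k m xhat l)"
proof -
  have "coord_values k m xhat l = (\<lambda>x. x $ l) ` support_union k m xhat"
    by (auto simp: coord_values_def)
  then show ?thesis
    by (simp add: support_union_def)
qed

text \<open>Every candidate lies in the finite grid of coordinate values, since points of the
  support union do so on \<open>T\<close> as well. Hence \<open>Min\<close> in
  \<open>restricted_cost\<close> is over a finite set.\<close>

lemma finite_S3: "finite (S3 k m xhat T)"
proof (rule finite_subset)
  show "S3 k m xhat T \<subseteq> vec_lambda ` (\<Pi>\<^sub>E l\<in>UNIV. coord_values k m xhat l)"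
  proof
    fix y assume y: "y \<in> S3 k m xhat T"
    have "y $ l \<in> coord_values k m xhat l" for l
      using y by (cases "l \<in> T") (auto simp: S3_def coord_values_def)
    then have "(\<lambda>l. y $ l) \<in> (\<Pi>\<^sub>E l\<in>UNIV. coord_values k m xhat l)"
      by auto
    moreover have "y = vec_lambda (\<lambda>l. y $ l)"
      by simp
    ultimately show "y \<in> vec_lambda ` (\<Pi>\<^sub>E l\<in>UNIV. coord_values k m xhat l)"
      by blast
  qed
  show "finite (vec_lambda ` (\<Pi>\<^sub>E l\<in>UNIV. coord_values k m xhat l))"
    by (intro finite_imageI finite_PiE finite_coord_values) auto
qed

lemma restricted_cost_le:
  assumes "finite S" "w \<in> S"
  shows "restricted_cost k lam xhat S js \<le> (\<Sum>i\<in>{1..k}. lam i * l1_norm (w - xhat i (js i)))"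
  unfolding restricted_cost_def using assms by (intro Min_le) auto

lemma restricted_cost_nonneg:
  assumes "finite S" "S \<noteq> {}" "\<And>i. i \<in> {1..k} \<Longrightarrow> 0 \<le> lam i"
  shows "0 \<le> restricted_cost k lam xhat S js"
  unfolding restricted_cost_def using assms
  by (subst Min_ge_iff) (auto intro!: sum_nonneg mult_nonneg_nonneg l1_norm_nonneg)

lemma finite_multi_indices: "finite (multi_indices k m)"
  unfolding multi_indices_def by (intro finite_PiE) auto

text \<open>A real-valued infimum is a lower bound only for a family bounded below. Nonnegative
  weights and tensors make 0 such a bound.\<close>

lemma restricted_value_le:
  assumes "finite S" "S \<noteq> {}" "\<And>i. i \<in> {1..k} \<Longrightarrow> 0 \<le> lam i" "X \<in> feasible_tensors k m p"
  shows "restricted_value k lam m p xhat S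
    \<le> (\<Sum>js\<in>multi_indices k m. restricted_cost k lam xhat S js * X js)"
  unfolding restricted_value_def
proof (rule cINF_lower[OF _ assms(4)], rule bdd_belowI2[where m = 0])
  fix Y assume "Y \<in> feasible_tensors k m p"
  then show "0 \<le> (\<Sum>js\<in>multi_indices k m. restricted_cost k lam xhat S js * Y js)"
    by (intro sum_nonneg mult_nonneg_nonneg restricted_cost_nonneg assms)
      (auto simp: feasible_tensors_def)
qed

text \<open>The l1 cost separates into one-dimensional costs \<open>c l\<close>, so the coordinates
  can be treated one at a time. The centre \<open>y\<close> on the right is arbitrary, which later
  allows integration over \<open>y\<close>.\<close>

lemma sum_restricted_cost_S3_le:
  fixes xhat :: "nat \<Rightarrow> nat \<Rightarrow> real ^ 'd"
  assumes lam: "\<And>i. i \<in> {1..k} \<Longrightarrow> 0 \<le> lam i" "(\<Sum>i\<in>{1..k}. lam i) = 1"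
    and js: "js \<in> multi_indices k m"
    and s: "s \<le> CARD('d)"
  shows "(\<Sum>T | card T = s. restricted_cost k lam xhat (S3 k m xhat T) js)
    \<le> real (CARD('d) choose s) * (1 + real s / real CARD('d))
       * (\<Sum>i\<in>{1..k}. lam i * l1_norm (y - xhat i (js i)))"
proof -
  define a where "a l i = xhat i (js i) $ l" for l i
  define c where "c l u = (\<Sum>i\<in>{1..k}. lam i * \<bar>u - a l i\<bar>)" for l u
  have cost: "(\<Sum>i\<in>{1..k}. lam i * l1_norm (w - xhat i (js i))) = (\<Sum>l\<in>UNIV. c l (w $ l))" for w
    unfolding l1_norm_def c_def a_def sum_distrib_left by (subst sum.swap) simp
  have k: "{1..k} \<noteq> {}"
    using lam(2) by force
  \<comment> \<open>The median in coordinate \<open>l\<close> is an entry of some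
    \<open>xhat i (js i)\<close>, and so belongs to \<open>coord_values\<close>.\<close>
  have "\<exists>r\<in>{1..k}. \<forall>u. c l (a l r) \<le> c l u" for l
  proof -
    obtain r where "r \<in> {1..k}" "\<And>u. c l (a l r) \<le> c l u"
      unfolding c_def using weighted_median[where w = lam and a = "a l", OF finite_atLeastAtMost k lam(1)] by blast
    then show ?thesis
      by blast
  qed
  then obtain r where r: "\<And>l. r l \<in> {1..k}" "\<And>l u. c l (a l (r l)) \<le> c l u"
    by metis
  define C where "C l = c l (a l (r l))" for l
  have supp: "xhat i (js i) \<in> support_union k m xhat" if "i \<in> {1..k}" for i
    using js that unfolding support_union_def multi_indices_def by blast
  \<comment> \<open>Going through the median by the triangle inequality bounds the cost of centre
    \<open>a l q\<close> by two distances. Since the weights sum to 1, each of them averages to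
    \<open>C l\<close>.\<close>
  have pairs: "(\<Sum>q\<in>{1..k}. lam q * c l (a l q)) \<le> 2 * C l" for l
  proof -
    have "(\<Sum>q\<in>{1..k}. lam q * c l (a l q))
        \<le> (\<Sum>q\<in>{1..k}. \<Sum>i\<in>{1..k}. lam q * lam i * (\<bar>a l (r l) - a l q\<bar> + \<bar>a l (r l) - a l i\<bar>))"
      unfolding c_def sum_distrib_left mult.assoc[symmetric]
      by (intro sum_mono mult_left_mono mult_nonneg_nonneg lam) auto
    also have "\<dots> = (\<Sum>q\<in>{1..k}. \<Sum>i\<in>{1..k}. lam i * (lam q * \<bar>a l (r l) - a l q\<bar>))
        + (\<Sum>q\<in>{1..k}. lam q * (\<Sum>i\<in>{1..k}. lam i * \<bar>a l (r l) - a l i\<bar>))"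
      unfolding sum_distrib_left sum.distrib[symmetric]
      by (intro sum.cong refl) (simp add: algebra_simps)
    also have "\<dots> = 2 * C l"
      unfolding sum_distrib_right[symmetric] lam(2) by (simp add: C_def c_def)
    finally show ?thesis .
  qed
  have one: "restricted_cost k lam xhat (S3 k m xhat T) js \<le> sum C UNIV + sum C T" for T
  proof -
    define w where "w q = (\<chi> l. if l \<in> T then a l q else a l (r l))" for q
    have wS: "w q \<in> S3 k m xhat T" if "q \<in> {1..k}" for q
      unfolding S3_def w_def coord_values_def using supp[OF that] supp[OF r(1)]
      by (auto simp: a_def)
    \<comment> \<open>A minimum is at most any convex combination of the values at candidates, here
      at the points \<open>w q\<close> with weights \<open>lam q\<close>.\<close>
    have "restricted_cost k lam xhat (S3 k m xhat T) js
        = (\<Sum>q\<in>{1..k}. lam q * restricted_cost k lam xhat (S3 k m xhat T) js)"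
      unfolding sum_distrib_right[symmetric] lam(2) by simp
    also have "\<dots> \<le> (\<Sum>q\<in>{1..k}. lam q * (\<Sum>l\<in>UNIV. c l (w q $ l)))"
      unfolding cost[symmetric]
      by (intro sum_mono mult_left_mono restricted_cost_le finite_S3 wS lam)
    also have "\<dots> = (\<Sum>l\<in>UNIV. \<Sum>q\<in>{1..k}. lam q * c l (w q $ l))"
      unfolding sum_distrib_left by (rule sum.swap)
    \<comment> \<open>Off \<open>T\<close> every \<open>w q\<close> has the median as its coordinate
      and costs \<open>C l\<close>. On \<open>T\<close> the average over \<open>q\<close> is bounded
      by \<open>pairs\<close>.\<close>
    also have "\<dots> \<le> (\<Sum>l\<in>UNIV. C l + (if l \<in> T then C l else 0))"
    proof (rule sum_mono)
      fix l
      show "(\<Sum>q\<in>{1..k}. lam q * c l (w q $ l)) \<le> C l + (if l \<in> T then C l else 0)"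
      proof (cases "l \<in> T")
        case True
        then show ?thesis using pairs[of l] by (simp add: w_def)
      next
        case False
        then show ?thesis
          unfolding w_def C_def by (simp only: vec_lambda_beta if_False sum_distrib_right[symmetric] lam(2))
      qed
    qed
    also have "\<dots> = sum C UNIV + sum C T"
      by (simp add: sum.distrib sum.If_cases)
    finally show ?thesis .
  qed
  have "(\<Sum>T | card T = s. restricted_cost k lam xhat (S3 k m xhat T) js)
      \<le> (\<Sum>T | card T = s. sum C UNIV + sum C (T :: 'd set))"
    by (intro sum_mono one)
  also have "\<dots> = real (CARD('d) choose s) * (1 + real s / real CARD('d)) * sum C UNIV"
    using n_subsets[of "UNIV :: 'd set" s]
    by (simp add: sum.distrib sum_uniform_subsets[OF s] algebra_simps)
  also have "\<dots> \<le> real (CARD('d) choose s) * (1 + real s / real CARD('d)) * (\<Sum>l\<in>UNIV. c l (y $ l))"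
    unfolding C_def by (intro mult_left_mono sum_mono r(2)) auto
  finally show ?thesis
    unfolding cost .
qed

section \<open>Couplings with a finitely supported measure\<close>

lemma prob_space_discrete_measure:
  assumes "\<And>j. j \<in> {1..m} \<Longrightarrow> 0 \<le> p j" "(\<Sum>j\<in>{1..m}. p j) = 1"
  shows "prob_space (discrete_measure m p x)"
proof
  have "emeasure (discrete_measure m p x) UNIV = (\<Sum>j\<in>{1..m}. ennreal (p j))"
    by (simp add: emeasure_discrete_measure)
  also have "\<dots> = 1"
    using assms by (subst sum_ennreal) auto
  finally show "emeasure (discrete_measure m p x) (space (discrete_measure m p x)) = 1"
    by (simp add: discrete_measure_def)
qed

lemma sets_discrete_measure [simp, measurable_cong]: "sets (discrete_measure m p x) = sets borel"
  by (simp add: discrete_measure_def)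

lemma AE_discrete_measure: "AE y in discrete_measure m p x. y \<in> x ` {1..m}"
proof (rule AE_I[where N = "- (x ` {1..m})"])
  have "closed (x ` {1..m})"
    by (intro finite_imp_closed) simp
  then show *: "- (x ` {1..m}) \<in> sets (discrete_measure m p x)"
    by simp
  then show "emeasure (discrete_measure m p x) (- (x ` {1..m})) = 0"
    by (simp add: emeasure_discrete_measure)
qed auto

text \<open>The product measure is a coupling. This makes the infimum in \<open>W1\<close> one over
  a nonempty set, so that nearly optimal couplings exist.\<close>

lemma couplings_nonempty:
  assumes "P \<in> P1_measures" "prob_space Q" "sets Q = sets borel"
  shows "couplings P Q \<noteq> {}"
proof -
  interpret P: prob_space P using assms by (simp add: P1_measures_def)
  interpret Q: prob_space Q by fact
  have sP[measurable_cong]: "sets P = sets borel"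
    using assms by (simp add: P1_measures_def)
  have spP: "space P = UNIV" and spQ: "space Q = UNIV"
    using sP assms(3) by (auto dest: sets_eq_imp_space_eq)
  note [measurable_cong] = assms(3)
  have "distr (P \<Otimes>\<^sub>M Q) borel fst = P"
  proof (rule measure_eqI)
    fix A assume "A \<in> sets (distr (P \<Otimes>\<^sub>M Q) borel fst)"
    then have A: "A \<in> sets P"
      by (simp add: sP)
    have "fst -` A \<inter> space (P \<Otimes>\<^sub>M Q) = A \<times> space Q"
      by (auto simp: space_pair_measure spP)
    then show "emeasure (distr (P \<Otimes>\<^sub>M Q) borel fst) A = emeasure P A"
      using A Q.emeasure_pair_measure_Times[OF A sets.top[of Q]]
      by (subst emeasure_distr) (auto simp: sP Q.emeasure_space_1)
  qed (simp add: sP)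
  moreover have "distr (P \<Otimes>\<^sub>M Q) borel snd = Q"
  proof (rule measure_eqI)
    fix A assume "A \<in> sets (distr (P \<Otimes>\<^sub>M Q) borel snd)"
    then have A: "A \<in> sets Q"
      by (simp add: assms)
    have "snd -` A \<inter> space (P \<Otimes>\<^sub>M Q) = space P \<times> A"
      by (auto simp: space_pair_measure spQ)
    then show "emeasure (distr (P \<Otimes>\<^sub>M Q) borel snd) A = emeasure Q A"
      using A Q.emeasure_pair_measure_Times[OF sets.top[of P] A]
      by (subst emeasure_distr) (auto simp: assms P.emeasure_space_1)
  qed (simp add: assms)
  ultimately have "P \<Otimes>\<^sub>M Q \<in> couplings P Q"
    by (simp add: couplings_def sets_pair_measure_cong[OF sP assms(3)])
  then show ?thesis
    by blast
qed

lemma AE_coupling_discrete_measure: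
  assumes "R \<in> couplings P (discrete_measure m p x)"
  shows "AE z in R. snd z \<in> x ` {1..m}"
proof -
  have "sets R = sets (borel \<Otimes>\<^sub>M borel)" and "distr R borel snd = discrete_measure m p x"
    using assms by (auto simp: couplings_def)
  note [measurable_cong] = this(1)
  have "snd \<in> measurable R borel"
    by measurable
  moreover have "AE y in distr R borel snd. y \<in> x ` {1..m}"
    unfolding \<open>distr R borel snd = _\<close> by (rule AE_discrete_measure)
  ultimately show ?thesis
    by (rule AE_distrD)
qed

text \<open>The weights \<open>f j y\<close> are the conditional probabilities of the second marginal being
  \<open>x j\<close> given the first marginal \<open>y\<close>; they are altered on a null set so as to sum to one everywhere.\<close>
lemma coupling_disintegration:
  fixes x :: "nat \<Rightarrow> real ^ 'd"
  assumes P: "prob_space P" "sets P = sets borel"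
    and R: "R \<in> couplings P (discrete_measure m p x)"
    and x: "inj_on x {1..m}" and m: "1 \<le> m"
  obtains f :: "nat \<Rightarrow> real ^ 'd \<Rightarrow> real"
  where "\<And>j. f j \<in> borel_measurable borel" "\<And>j y. 0 \<le> f j y" "\<And>y. (\<Sum>j\<in>{1..m}. f j y) = 1"
    "\<And>j g. \<lbrakk>j \<in> {1..m}; g \<in> borel_measurable borel\<rbrakk> \<Longrightarrow>
       (\<integral>\<^sup>+z. g (fst z) * indicator {x j} (snd z) \<partial>R) = (\<integral>\<^sup>+y. ennreal (f j y) * g y \<partial>P)"
proof -
  interpret P: prob_space P by fact
  note [measurable_cong] = P(2)
  have sR[measurable_cong]: "sets R = sets (borel \<Otimes>\<^sub>M borel)"
    and fstR: "distr R borel fst = P" and sndR: "distr R borel snd = discrete_measure m p x"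
    using R by (auto simp: couplings_def)
  \<comment> \<open>\<open>N j\<close> is the first marginal of the part of \<open>R\<close> whose
    second coordinate is \<open>x j\<close>. It is dominated by \<open>P\<close>, which gives both
    finiteness and absolute continuity for Radon-Nikodym.\<close>
  define N where "N j = distr (density R (\<lambda>z. indicator {x j} (snd z))) borel fst" for j
  have N: "(\<integral>\<^sup>+y. g y \<partial>N j) = (\<integral>\<^sup>+z. g (fst z) * indicator {x j} (snd z) \<partial>R)"
    if [measurable]: "g \<in> borel_measurable borel" for g j
    unfolding N_def
    by (subst nn_integral_distr, measurable, subst nn_integral_density) (auto simp: mult.commute)
  have fst_int: "(\<integral>\<^sup>+z. g (fst z) \<partial>R) = (\<integral>\<^sup>+y. g y \<partial>P)"
    if [measurable]: "g \<in> borel_measurable borel" for g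
    unfolding fstR[symmetric] by (subst nn_integral_distr) auto
  have N_le: "emeasure (N j) A \<le> emeasure P A" if A[measurable]: "A \<in> sets borel" for A j
  proof -
    have "emeasure (N j) A = (\<integral>\<^sup>+y. indicator A y \<partial>N j)"
      using A by (simp add: N_def)
    also have "\<dots> \<le> (\<integral>\<^sup>+z. indicator A (fst z) \<partial>R)"
      by (subst N) (auto intro!: nn_integral_mono simp: indicator_def)
    also have "\<dots> = emeasure P A"
      using A P(2) by (subst fst_int) auto
    finally show ?thesis .
  qed
  have "\<exists>g\<in>borel_measurable P. density P g = N j" for j
  proof (rule P.Radon_Nikodym_finite_measure)
    show "finite_measure (N j)"
      using N_le[of UNIV j] P.emeasure_finite
      by (intro finite_measureI) (auto simp: N_def top_unique)
    show "sets (N j) = sets P"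
      by (simp add: N_def P)
    show "absolutely_continuous P (N j)"
      using N_le[of _ j] P(2)
      by (auto simp: absolutely_continuous_def null_sets_def N_def) (metis le_zero_eq)
  qed
  then obtain g where g: "\<And>j. g j \<in> borel_measurable P" "\<And>j. density P (g j) = N j"
    by metis
  have [measurable]: "g j \<in> borel_measurable borel" for j
    using g(1)[of j] by measurable
  note AER = AE_coupling_discrete_measure[OF R]
  \<comment> \<open>The measures \<open>N j\<close> add up to \<open>P\<close>: almost surely the
    second coordinate is one of the \<open>x j\<close>, and by injectivity exactly one indicator is
    then 1. Uniqueness of densities gives the claim.\<close>
  have "AE y in P. (\<Sum>j\<in>{1..m}. g j y) = 1"
  proof (rule P.density_unique)
    show "density P (\<lambda>y. \<Sum>j\<in>{1..m}. g j y) = density P (\<lambda>y. 1)"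
    proof (rule measure_eqI)
      fix A assume "A \<in> sets (density P (\<lambda>y. \<Sum>j\<in>{1..m}. g j y))"
      then have A[measurable]: "A \<in> sets borel"
        by (simp add: P)
      have "emeasure (density P (\<lambda>y. \<Sum>j\<in>{1..m}. g j y)) A
          = (\<integral>\<^sup>+y. (\<Sum>j\<in>{1..m}. g j y * indicator A y) \<partial>P)"
        unfolding sum_distrib_right[symmetric] by (rule emeasure_density) (auto simp: A P(2))
      also have "\<dots> = (\<Sum>j\<in>{1..m}. \<integral>\<^sup>+y. g j y * indicator A y \<partial>P)"
        by (rule nn_integral_sum) measurable
      also have "\<dots> = (\<Sum>j\<in>{1..m}. \<integral>\<^sup>+z. indicator A (fst z) * indicator {x j} (snd z) \<partial>R)"
      proof (rule sum.cong[OF refl])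
        fix j
        have "(\<integral>\<^sup>+y. g j y * indicator A y \<partial>P) = (\<integral>\<^sup>+y. indicator A y \<partial>density P (g j))"
          by (rule nn_integral_density[symmetric]) measurable
        also have "\<dots> = (\<integral>\<^sup>+z. indicator A (fst z) * indicator {x j} (snd z) \<partial>R)"
          unfolding g(2) by (rule N) measurable
        finally show "(\<integral>\<^sup>+y. g j y * indicator A y \<partial>P)
          = (\<integral>\<^sup>+z. indicator A (fst z) * indicator {x j} (snd z) \<partial>R)" .
      qed
      also have "\<dots> = (\<integral>\<^sup>+z. (\<Sum>j\<in>{1..m}. indicator A (fst z) * indicator {x j} (snd z)) \<partial>R)"
        by (rule nn_integral_sum[symmetric]) measurable
      also have "\<dots> = (\<integral>\<^sup>+z. indicator A (fst z) \<partial>R)"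
      proof (rule nn_integral_cong_AE, use AER in eventually_elim)
        fix z :: "(real ^ 'd) \<times> (real ^ 'd)" assume "snd z \<in> x ` {1..m}"
        then obtain i where i: "snd z = x i" "i \<in> {1..m}"
          by (rule imageE)
        have "(\<Sum>j\<in>{1..m}. indicator {x j} (snd z)) = (\<Sum>j\<in>{1..m}. if i = j then 1 else (0::ennreal))"
          unfolding i(1) by (intro sum.cong refl) (simp add: indicator_def inj_on_eq_iff[OF x i(2)])
        then show "(\<Sum>j\<in>{1..m}. indicator A (fst z) * indicator {x j} (snd z)) = (indicator A (fst z) :: ennreal)"
          using i by (simp add: flip: sum_distrib_left)
      qed
      also have "\<dots> = emeasure (density P (\<lambda>y. 1)) A"
        using A by (subst fst_int) (auto simp: P emeasure_density)
      finally show "emeasure (density P (\<lambda>y. \<Sum>j\<in>{1..m}. g j y)) A = emeasure (density P (\<lambda>y. 1)) A" .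
    qed simp
  qed (use g in auto)
  \<comment> \<open>Where the densities do not sum to 1, all mass goes to index 1, which exists
    because \<open>1 \<le> m\<close>. The sum is thus 1 at every point.\<close>
  define f where "f j y = (if (\<Sum>j\<in>{1..m}. g j y) = 1 then enn2real (g j y) else indicator {1} j)" for j y
  \<comment> \<open>Nonnegative terms summing to 1 are at most 1, hence finite, so
    \<open>enn2real\<close> loses nothing.\<close>
  have g_eq: "ennreal (enn2real (g j y)) = g j y"
    if "(\<Sum>j\<in>{1..m}. g j y) = 1" "j \<in> {1..m}" for j y
  proof -
    have "g j y \<le> 1"
      using member_le_sum[of j "{1..m}" "\<lambda>j. g j y"] that by simp
    then show ?thesis
      by (metis ennreal_enn2real ennreal_one_less_top order.strict_trans1)
  qed
  show ?thesis
  proof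
    show "f j \<in> borel_measurable borel" for j
      unfolding f_def by measurable
    show "0 \<le> f j y" for j y
      by (simp add: f_def)
    show "(\<Sum>j\<in>{1..m}. f j y) = 1" for y
    proof (cases "(\<Sum>j\<in>{1..m}. g j y) = 1")
      case True
      have "ennreal (\<Sum>j\<in>{1..m}. f j y) = (\<Sum>j\<in>{1..m}. ennreal (f j y))"
        by (rule sum_ennreal[symmetric]) (simp add: f_def)
      also have "\<dots> = (\<Sum>j\<in>{1..m}. g j y)"
        unfolding f_def if_P[OF True] by (intro sum.cong refl g_eq True)
      finally show ?thesis
        unfolding True by simp
    next
      case False
      have "(\<Sum>j\<in>{1..m}. f j y) = (\<Sum>j\<in>{1..m}. if j = 1 then 1 else 0)"
        unfolding f_def if_not_P[OF False] by (rule sum.cong) (auto simp: indicator_def)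
      also have "\<dots> = 1"
        using m by (subst sum.delta) auto
      finally show ?thesis .
    qed
    fix j and h :: "real ^ 'd \<Rightarrow> ennreal"
    assume j: "j \<in> {1..m}" and h[measurable]: "h \<in> borel_measurable borel"
    have "AE y in P. g j y * h y = ennreal (f j y) * h y"
      using \<open>AE y in P. (\<Sum>j\<in>{1..m}. g j y) = 1\<close>
    proof eventually_elim
      fix y assume *: "(\<Sum>j\<in>{1..m}. g j y) = 1"
      have "ennreal (f j y) = g j y"
        unfolding f_def if_P[OF *] by (rule g_eq[OF * j])
      then show "g j y * h y = ennreal (f j y) * h y"
        by (rule arg_cong[OF sym])
    qed
    then have h_eq: "(\<integral>\<^sup>+y. g j y * h y \<partial>P) = (\<integral>\<^sup>+y. ennreal (f j y) * h y \<partial>P)"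
      by (rule nn_integral_cong_AE)
    have "(\<integral>\<^sup>+z. h (fst z) * indicator {x j} (snd z) \<partial>R) = (\<integral>\<^sup>+y. g j y * h y \<partial>P)"
      using N[of h j] unfolding g(2)[symmetric] by (simp add: nn_integral_density)
    also have "\<dots> = (\<integral>\<^sup>+y. ennreal (f j y) * h y \<partial>P)"
      by (rule h_eq)
    finally show "(\<integral>\<^sup>+z. h (fst z) * indicator {x j} (snd z) \<partial>R) = (\<integral>\<^sup>+y. ennreal (f j y) * h y \<partial>P)" .
  qed
qed

text \<open>Two kinds of test function are put into the disintegration: the constant 1 yields the
  weights \<open>p j\<close>, and the distances to the \<open>x j\<close>, summed over
  \<open>j\<close>, yield the transport cost.\<close>

lemma coupling_kernel:
  fixes x :: "nat \<Rightarrow> real ^ 'd"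
  assumes P: "P \<in> P1_measures"
    and R: "R \<in> couplings P (discrete_measure m p x)"
    and x: "inj_on x {1..m}" and m: "1 \<le> m" and p: "\<And>j. j \<in> {1..m} \<Longrightarrow> 0 \<le> p j"
  obtains f :: "nat \<Rightarrow> real ^ 'd \<Rightarrow> real"
  where "\<And>j. f j \<in> borel_measurable borel" "\<And>j y. 0 \<le> f j y" "\<And>y. (\<Sum>j\<in>{1..m}. f j y) = 1"
    "\<And>j. j \<in> {1..m} \<Longrightarrow> (\<integral>y. f j y \<partial>P) = p j"
    "(\<integral>y. (\<Sum>j\<in>{1..m}. f j y * l1_norm (y - x j)) \<partial>P) = (\<integral>z. l1_norm (fst z - snd z) \<partial>R)"
proof -
  have P': "prob_space P" "sets P = sets borel"
    using P by (auto simp: P1_measures_def)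
  note [measurable_cong] = P'(2)
  have [measurable_cong]: "sets R = sets (borel \<Otimes>\<^sub>M borel)"
    and sndR: "distr R borel snd = discrete_measure m p x"
    using R by (auto simp: couplings_def)
  note AER = AE_coupling_discrete_measure[OF R]
  obtain f where f[measurable]: "\<And>j. f j \<in> borel_measurable borel"
    and f0: "\<And>j y. 0 \<le> f j y" and f1: "\<And>y. (\<Sum>j\<in>{1..m}. f j y) = 1"
    and f_int: "\<And>j g. \<lbrakk>j \<in> {1..m}; g \<in> borel_measurable borel\<rbrakk> \<Longrightarrow>
       (\<integral>\<^sup>+z. g (fst z) * indicator {x j} (snd z) \<partial>R) = (\<integral>\<^sup>+y. ennreal (f j y) * g y \<partial>P)"
    by (fact coupling_disintegration[OF P' R x m])
  show ?thesis
  proof (rule that[OF f f0 f1])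
    fix j assume j: "j \<in> {1..m}"
    have "(\<integral>\<^sup>+y. ennreal (f j y) \<partial>P) = (\<integral>\<^sup>+z. indicator {x j} (snd z) \<partial>R)"
      using f_int[OF j, of "\<lambda>_. 1"] by simp
    also have "\<dots> = (\<integral>\<^sup>+z. indicator {x j} z \<partial>discrete_measure m p x)"
      unfolding sndR[symmetric] by (subst nn_integral_distr) auto
    also have "\<dots> = (\<Sum>i\<in>{1..m}. ennreal (p i) * indicator {x j} (x i))"
      by (simp add: emeasure_discrete_measure)
    also have "\<dots> = (\<Sum>i\<in>{1..m}. if i = j then ennreal (p i) else 0)"
      using inj_on_eq_iff[OF x _ j] by (intro sum.cong refl) (auto simp: indicator_def)
    also have "\<dots> = ennreal (p j)"
      using j by simp
    finally show "(\<integral>y. f j y \<partial>P) = p j"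
      using p[OF j] f0 by (simp add: integral_eq_nn_integral)
  next
    \<comment> \<open>The costs are compared as nonnegative integrals, and
      \<open>integral_eq_nn_integral\<close> carries the equality over to Bochner integrals.\<close>
    have "(\<integral>\<^sup>+z. l1_norm (fst z - snd z) \<partial>R)
        = (\<integral>\<^sup>+z. (\<Sum>j\<in>{1..m}. ennreal (l1_norm (fst z - x j)) * indicator {x j} (snd z)) \<partial>R)"
    proof (rule nn_integral_cong_AE, use AER in eventually_elim)
      fix z :: "(real ^ 'd) \<times> (real ^ 'd)" assume "snd z \<in> x ` {1..m}"
      then obtain i where i: "snd z = x i" "i \<in> {1..m}"
        by (rule imageE)
      have "(\<Sum>j\<in>{1..m}. ennreal (l1_norm (fst z - x j)) * indicator {x j} (snd z))
          = (\<Sum>j\<in>{1..m}. if i = j then ennreal (l1_norm (fst z - snd z)) else 0)"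
        unfolding i(1) by (intro sum.cong refl) (simp add: indicator_def inj_on_eq_iff[OF x i(2)])
      then show "ennreal (l1_norm (fst z - snd z))
          = (\<Sum>j\<in>{1..m}. ennreal (l1_norm (fst z - x j)) * indicator {x j} (snd z))"
        using i by simp
    qed
    also have "\<dots> = (\<Sum>j\<in>{1..m}. \<integral>\<^sup>+z. ennreal (l1_norm (fst z - x j)) * indicator {x j} (snd z) \<partial>R)"
      by (rule nn_integral_sum) measurable
    also have "\<dots> = (\<Sum>j\<in>{1..m}. \<integral>\<^sup>+y. ennreal (f j y) * ennreal (l1_norm (y - x j)) \<partial>P)"
      by (intro sum.cong refl f_int) measurable
    also have "\<dots> = (\<integral>\<^sup>+y. (\<Sum>j\<in>{1..m}. ennreal (f j y) * ennreal (l1_norm (y - x j))) \<partial>P)"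
      by (rule nn_integral_sum[symmetric]) measurable
    also have "\<dots> = (\<integral>\<^sup>+y. ennreal (\<Sum>j\<in>{1..m}. f j y * l1_norm (y - x j)) \<partial>P)"
      by (intro nn_integral_cong) (simp add: f0 l1_norm_nonneg ennreal_mult flip: sum_ennreal)
    finally show "(\<integral>y. (\<Sum>j\<in>{1..m}. f j y * l1_norm (y - x j)) \<partial>P) = (\<integral>z. l1_norm (fst z - snd z) \<partial>R)"
      by (simp add: integral_eq_nn_integral f0 l1_norm_nonneg sum_nonneg)
  qed
qed

section \<open>The feasible tensor built from a family of couplings\<close>

lemma sum_multi_indices_prod:
  fixes f :: "nat \<Rightarrow> nat \<Rightarrow> real"
  assumes "\<And>i. i \<in> {1..k} \<Longrightarrow> (\<Sum>j\<in>{1..m i}. f i j) = 1" and i: "i \<in> {1..k}"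
  shows "(\<Sum>js\<in>multi_indices k m. h (js i) * (\<Prod>i\<in>{1..k}. f i (js i))) = (\<Sum>j\<in>{1..m i}. h j * f i j)"
proof -
  \<comment> \<open>Attaching \<open>h\<close> to the factor with index \<open>i\<close> turns the
    summand into a pure product. The sum then factorises, and every other factor is 1.\<close>
  define F where "F i' j = (if i' = i then h j else 1) * f i' j" for i' j
  have "(\<Sum>js\<in>multi_indices k m. h (js i) * (\<Prod>i\<in>{1..k}. f i (js i)))
      = (\<Sum>js\<in>multi_indices k m. \<Prod>i\<in>{1..k}. F i (js i))"
    using i by (simp add: F_def prod.distrib)
  also have "\<dots> = (\<Prod>i\<in>{1..k}. \<Sum>j\<in>{1..m i}. F i j)"
    unfolding multi_indices_def by (rule prod_sum_PiE[symmetric]) auto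
  also have "\<dots> = (\<Prod>i'\<in>{1..k}. if i' = i then \<Sum>j\<in>{1..m i}. h j * f i j else 1)"
    using assms(1) by (intro prod.cong refl) (auto simp: F_def)
  finally show ?thesis
    using i by simp
qed

lemma S3_nonempty:
  assumes "1 \<le> k" "1 \<le> m 1"
  shows "S3 k m xhat T \<noteq> {}"
proof -
  have "xhat 1 1 \<in> support_union k m xhat"
    unfolding support_union_def by (rule UN_I[of 1]) (use assms in auto)
  then have "xhat 1 1 \<in> S3 k m xhat T"
    unfolding S3_def coord_values_def by blast
  then show ?thesis
    by blast
qed

lemma integrable_l1_norm_diff:
  assumes "P \<in> P1_measures"
  shows "integrable P (\<lambda>y. l1_norm (y - x))"
proof -
  interpret prob_space P
    using assms by (simp add: P1_measures_def)
  have [measurable_cong]: "sets P = sets borel" and [simp]: "integrable P l1_norm"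
    using assms by (auto simp: P1_measures_def)
  show ?thesis
  proof (rule Bochner_Integration.integrable_bound[where f = "\<lambda>y. l1_norm y + l1_norm x"])
    show "AE y in P. norm (l1_norm (y - x)) \<le> norm (l1_norm y + l1_norm x)"
      by (intro AE_I2) (simp add: l1_norm_nonneg l1_norm_triangle)
    show "(\<lambda>y. l1_norm (y - x)) \<in> borel_measurable P"
      by measurable
  qed simp
qed

text \<open>The tensor built from the couplings does not depend on \<open>T\<close>. One tensor
  therefore serves all candidate supports, and the sum over \<open>T\<close> can be moved inside the
  sum over multi-indices.\<close>

lemma average_restricted_value_le_couplings:
  fixes xhat :: "nat \<Rightarrow> nat \<Rightarrow> real ^ 'd"
  assumes m: "\<And>i. i \<in> {1..k} \<Longrightarrow> 1 \<le> m i"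
    and inj: "\<And>i. i \<in> {1..k} \<Longrightarrow> inj_on (xhat i) {1..m i}"
    and p: "\<And>i j. i \<in> {1..k} \<Longrightarrow> j \<in> {1..m i} \<Longrightarrow> 0 \<le> p i j"
    and lam: "\<And>i. i \<in> {1..k} \<Longrightarrow> 0 \<le> lam i" "(\<Sum>i\<in>{1..k}. lam i) = 1"
    and s: "s \<le> CARD('d)"
    and P: "P \<in> P1_measures"
    and R: "\<And>i. i \<in> {1..k} \<Longrightarrow> R i \<in> couplings P (discrete_measure (m i) (p i) (xhat i))"
  shows "(\<Sum>T | card T = s. restricted_value k lam m p xhat (S3 k m xhat T))
    \<le> real (CARD('d) choose s) * (1 + real s / real CARD('d))
       * (\<Sum>i\<in>{1..k}. lam i * (\<integral>z. l1_norm (fst z - snd z) \<partial>R i))"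
    (is "_ \<le> ?K * _")
proof -
  interpret prob_space P
    using P by (simp add: P1_measures_def)
  have [measurable_cong]: "sets P = sets borel"
    using P by (simp add: P1_measures_def)
  let ?J = "multi_indices k m"
  have "k \<noteq> 0"
    using lam(2) by (cases k) auto
  then have nonempty: "S3 k m xhat T \<noteq> {}" for T
    using m[of 1] by (intro S3_nonempty) auto
  \<comment> \<open>Collecting the properties in one predicate lets a single choice over
    \<open>i\<close> produce the whole family \<open>f\<close>.\<close>
  define kernel where "kernel i f \<longleftrightarrow> (\<forall>j. f j \<in> borel_measurable borel) \<and> (\<forall>j y. 0 \<le> f j y)
      \<and> (\<forall>y. (\<Sum>j\<in>{1..m i}. f j y) = 1) \<and> (\<forall>j\<in>{1..m i}. (\<integral>y. f j y \<partial>P) = p i j)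
      \<and> (\<integral>y. (\<Sum>j\<in>{1..m i}. f j y * l1_norm (y - xhat i j)) \<partial>P) = (\<integral>z. l1_norm (fst z - snd z) \<partial>R i)"
    for i and f :: "nat \<Rightarrow> real ^ 'd \<Rightarrow> real"
  have "\<exists>f. kernel i f" if i: "i \<in> {1..k}" for i
  proof (rule coupling_kernel[OF P R[OF i] inj[OF i] m[OF i] p[OF i]])
    fix f :: "nat \<Rightarrow> real ^ 'd \<Rightarrow> real"
    assume "\<And>j. f j \<in> borel_measurable borel" "\<And>j y. 0 \<le> f j y"
      "\<And>y. (\<Sum>j\<in>{1..m i}. f j y) = 1"
      "\<And>j. j \<in> {1..m i} \<Longrightarrow> (\<integral>y. f j y \<partial>P) = p i j"
      "(\<integral>y. (\<Sum>j\<in>{1..m i}. f j y * l1_norm (y - xhat i j)) \<partial>P)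
        = (\<integral>z. l1_norm (fst z - snd z) \<partial>R i)"
    then have "kernel i f"
      unfolding kernel_def by blast
    then show ?thesis
      by blast
  qed
  then obtain f where f: "\<And>i. i \<in> {1..k} \<Longrightarrow> kernel i (f i)"
    by metis
  have f_meas: "f i j \<in> borel_measurable borel"
    and f0: "0 \<le> f i j y"
    and f1: "(\<Sum>j\<in>{1..m i}. f i j y) = 1"
    and fp: "j \<in> {1..m i} \<Longrightarrow> (\<integral>y. f i j y \<partial>P) = p i j"
    and fR: "(\<integral>y. (\<Sum>j\<in>{1..m i}. f i j y * l1_norm (y - xhat i j)) \<partial>P)
      = (\<integral>z. l1_norm (fst z - snd z) \<partial>R i)"
    if "i \<in> {1..k}" for i j y
    using f[OF that] unfolding kernel_def by blast+
  have f_le: "f i j y \<le> 1" if "i \<in> {1..k}" "j \<in> {1..m i}" for i j y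
    using member_le_sum[of j "{1..m i}" "\<lambda>j. f i j y"] f0 f1 that by simp
  \<comment> \<open>Given the common point \<open>y\<close>, the indices are made independent, the
    \<open>i\<close>-th having law \<open>f i _ y\<close>.\<close>
  define g where "g js y = (\<Prod>i\<in>{1..k}. f i (js i) y)" for js y
  define D where "D js y = (\<Sum>i\<in>{1..k}. lam i * l1_norm (y - xhat i (js i)))" for js y
  have g_meas: "g js \<in> borel_measurable P" for js
    unfolding g_def using f_meas by (intro borel_measurable_prod) auto
  have g0: "0 \<le> g js y" for js y
    unfolding g_def by (intro prod_nonneg) (use f0 in auto)
  have g1: "g js y \<le> 1" if "js \<in> ?J" for js y
    unfolding g_def
    by (intro prod_le_1) (use f0 f_le that in \<open>auto simp: multi_indices_def PiE_iff\<close>)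
  have g_int: "integrable P (g js)" if "js \<in> ?J" for js
    using g0 g1[OF that] g_meas by (intro integrable_const_bound[where B = 1]) auto
  \<comment> \<open>The weights \<open>g js y\<close> lie between 0 and 1, so they preserve
    integrability.\<close>
  have gF_int: "integrable P (\<lambda>y. F y * g js y)" if "js \<in> ?J" "integrable P F" for js and F :: "_ \<Rightarrow> real"
  proof (rule Bochner_Integration.integrable_bound[OF that(2)])
    show "(\<lambda>y. F y * g js y) \<in> borel_measurable P"
      using that g_meas by (intro borel_measurable_times) auto
    show "AE y in P. norm (F y * g js y) \<le> norm (F y)"
      using g0 g1[OF that(1)] by (intro AE_I2) (auto simp: abs_mult intro!: mult_right_le_one_le)
  qed
  have D_int: "integrable P (D js)" for js
    unfolding D_def using integrable_l1_norm_diff[OF P] by auto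
  have marg: "(\<Sum>js\<in>?J. h (js i) * g js y) = (\<Sum>j\<in>{1..m i}. h j * f i j y)"
    if "i \<in> {1..k}" for h :: "nat \<Rightarrow> real" and i y
    unfolding g_def by (rule sum_multi_indices_prod[OF f1 that])
  define X where "X js = (\<integral>y. g js y \<partial>P)" for js
  have X: "X \<in> feasible_tensors k m p"
    unfolding feasible_tensors_def
  proof (intro CollectI conjI ballI)
    show "0 \<le> X js" for js
      unfolding X_def using g0 by (intro integral_nonneg_AE) auto
    fix i j assume i: "i \<in> {1..k}" and j: "j \<in> {1..m i}"
    have "sum X {js \<in> ?J. js i = j} = (\<integral>y. (\<Sum>js\<in>{js \<in> ?J. js i = j}. g js y) \<partial>P)"
      unfolding X_def by (intro Bochner_Integration.integral_sum[symmetric] g_int) simp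
    also have "\<dots> = (\<integral>y. f i j y \<partial>P)"
    proof (intro Bochner_Integration.integral_cong refl)
      fix y
      \<comment> \<open>The constraint on the \<open>i\<close>-th index becomes a 0-1 function of
        \<open>js i\<close>, to which \<open>marg\<close> applies.\<close>
      have "(\<Sum>js\<in>{js \<in> ?J. js i = j}. g js y) = (\<Sum>js\<in>?J. of_bool (js i = j) * g js y)"
        using finite_multi_indices[of k m] by (intro sum.mono_neutral_cong_left) auto
      also have "\<dots> = (\<Sum>j'\<in>{1..m i}. of_bool (j' = j) * f i j' y)"
        by (rule marg[OF i])
      also have "\<dots> = (\<Sum>j'\<in>{1..m i}. if j' = j then f i j' y else 0)"
        by (intro sum.cong) auto
      also have "\<dots> = f i j y"
        using j by simp
      finally show "(\<Sum>js\<in>{js \<in> ?J. js i = j}. g js y) = f i j y" .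
    qed
    finally show "sum X {js \<in> ?J. js i = j} = p i j"
      using fp[OF i j] by simp
  qed
  have "(\<Sum>T | card T = s. restricted_value k lam m p xhat (S3 k m xhat T))
      \<le> (\<Sum>T | card T = s. \<Sum>js\<in>?J. restricted_cost k lam xhat (S3 k m xhat T) js * X js)"
    by (intro sum_mono restricted_value_le finite_S3 nonempty lam X)
  also have "\<dots> = (\<Sum>js\<in>?J. (\<Sum>T | card T = s. restricted_cost k lam xhat (S3 k m xhat T) js) * X js)"
    unfolding sum_distrib_right by (rule sum.swap)
  also have "\<dots> \<le> (\<Sum>js\<in>?J. ?K * (\<integral>y. D js y * g js y \<partial>P))"
  proof (rule sum_mono)
    fix js assume js: "js \<in> ?J"
    let ?A = "\<Sum>T | card T = s. restricted_cost k lam xhat (S3 k m xhat T) js"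
    have "?A * X js = (\<integral>y. ?A * g js y \<partial>P)"
      unfolding X_def by simp
    \<comment> \<open>The cost comparison holds for every centre, so it may be applied with the
      integration variable \<open>y\<close> as centre.\<close>
    also have "\<dots> \<le> (\<integral>y. (?K * D js y) * g js y \<partial>P)"
    proof (rule integral_mono)
      show "integrable P (\<lambda>y. ?A * g js y)"
        using g_int[OF js] by simp
      show "integrable P (\<lambda>y. (?K * D js y) * g js y)"
        by (intro gF_int js integrable_mult_right D_int)
      show "?A * g js y \<le> (?K * D js y) * g js y" for y
        unfolding D_def using sum_restricted_cost_S3_le[OF lam js s]
        by (intro mult_right_mono g0) blast
    qed
    also have "\<dots> = ?K * (\<integral>y. D js y * g js y \<partial>P)"
      unfolding mult.assoc by simp
    finally show "?A * X js \<le> ?K * (\<integral>y. D js y * g js y \<partial>P)" .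
  qed
  also have "\<dots> = ?K * (\<integral>y. (\<Sum>js\<in>?J. D js y * g js y) \<partial>P)"
    unfolding sum_distrib_left[symmetric]
    by (subst Bochner_Integration.integral_sum) (auto intro: gF_int D_int)
  \<comment> \<open>Each summand of \<open>D\<close> depends on a single index, so
    \<open>marg\<close> sums out all the others and leaves the integrand of the coupling cost in
    \<open>fR\<close>.\<close>
  also have "(\<lambda>y. \<Sum>js\<in>?J. D js y * g js y)
      = (\<lambda>y. \<Sum>i\<in>{1..k}. lam i * (\<Sum>j\<in>{1..m i}. f i j y * l1_norm (y - xhat i j)))"
  proof
    fix y
    have "(\<Sum>js\<in>?J. D js y * g js y)
        = (\<Sum>i\<in>{1..k}. lam i * (\<Sum>js\<in>?J. l1_norm (y - xhat i (js i)) * g js y))"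
      unfolding D_def sum_distrib_right sum_distrib_left mult.assoc by (rule sum.swap)
    also have "\<dots> = (\<Sum>i\<in>{1..k}. lam i * (\<Sum>j\<in>{1..m i}. f i j y * l1_norm (y - xhat i j)))"
    proof (rule sum.cong[OF refl])
      fix i assume "i \<in> {1..k}"
      from marg[OF this, of "\<lambda>j. l1_norm (y - xhat i j)" y]
      show "lam i * (\<Sum>js\<in>?J. l1_norm (y - xhat i (js i)) * g js y)
          = lam i * (\<Sum>j\<in>{1..m i}. f i j y * l1_norm (y - xhat i j))"
        by (simp only: mult.commute[of "f i _ y"])
    qed
    finally show "(\<Sum>js\<in>?J. D js y * g js y)
        = (\<Sum>i\<in>{1..k}. lam i * (\<Sum>j\<in>{1..m i}. f i j y * l1_norm (y - xhat i j)))" .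
  qed
  also have "(\<integral>y. (\<Sum>i\<in>{1..k}. lam i * (\<Sum>j\<in>{1..m i}. f i j y * l1_norm (y - xhat i j))) \<partial>P)
      = (\<Sum>i\<in>{1..k}. lam i * (\<integral>z. l1_norm (fst z - snd z) \<partial>R i))"
  proof -
    have "integrable P (\<lambda>y. f i j y * l1_norm (y - xhat i j))"
      if "i \<in> {1..k}" "j \<in> {1..m i}" for i j
    proof (rule Bochner_Integration.integrable_bound[OF integrable_l1_norm_diff[OF P, of "xhat i j"]])
      show "(\<lambda>y. f i j y * l1_norm (y - xhat i j)) \<in> borel_measurable P"
        using f_meas[OF that(1), of j] by measurable
      show "AE y in P. norm (f i j y * l1_norm (y - xhat i j)) \<le> norm (l1_norm (y - xhat i j))"
        using f0[OF that(1)] f_le[OF that]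
        by (intro AE_I2) (auto simp: abs_mult l1_norm_nonneg intro!: mult_left_le_one_le)
    qed
    then have "(\<integral>y. (\<Sum>i\<in>{1..k}. lam i * (\<Sum>j\<in>{1..m i}. f i j y * l1_norm (y - xhat i j))) \<partial>P)
        = (\<Sum>i\<in>{1..k}. \<integral>y. lam i * (\<Sum>j\<in>{1..m i}. f i j y * l1_norm (y - xhat i j)) \<partial>P)"
      by (intro Bochner_Integration.integral_sum integrable_mult_right Bochner_Integration.integrable_sum)
    also have "\<dots> = (\<Sum>i\<in>{1..k}. lam i * (\<integral>z. l1_norm (fst z - snd z) \<partial>R i))"
      by (intro sum.cong refl) (simp only: integral_mult_right_zero fR)
    finally show ?thesis .
  qed
  finally show ?thesis .
qed

section \<open>Passage to the infimum over measures and couplings\<close>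

lemma P1_measures_nonempty: "(P1_measures :: (real ^ 'd) measure set) \<noteq> {}"
proof -
  have "return borel 0 \<in> (P1_measures :: (real ^ 'd) measure set)"
    by (auto simp: P1_measures_def prob_space_return nn_integral_return intro!: integrableI_bounded)
  then show ?thesis
    by blast
qed

theorem theorem7:
  fixes k n t :: nat
    and lam :: "nat \<Rightarrow> real"
    and m :: "nat \<Rightarrow> nat"
    and p :: "nat \<Rightarrow> nat \<Rightarrow> real"
    and xhat :: "nat \<Rightarrow> nat \<Rightarrow> real ^ 'd"
  assumes "\<forall>i\<in>{1..k}. 1 \<le> m i \<and> m i \<le> n"
    and "\<forall>i\<in>{1..k}. inj_on (xhat i) {1..m i}"
    and "\<forall>i\<in>{1..k}. \<forall>j\<in>{1..m i}. 0 \<le> p i j"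
    and "\<forall>i\<in>{1..k}. (\<Sum>j\<in>{1..m i}. p i j) = 1"
    and "\<forall>i\<in>{1..k}. 0 \<le> lam i"
    and "(\<Sum>i\<in>{1..k}. lam i) = 1"
    and "t \<le> CARD('d)"
  shows "measure_pmf.expectation (pmf_of_set {T :: 'd set. card T = CARD('d) - t})
           (\<lambda>T. restricted_value k lam m p xhat (S3 k m xhat T))
         \<le> (1 + (real CARD('d) - real t) / real CARD('d)) * barycenter_value k lam m p xhat"
proof -
  define s where "s = CARD('d) - t"
  define K where "K = 1 + real s / real CARD('d)"
  define V where "V = (\<Sum>T | card T = s. restricted_value k lam m p xhat (S3 k m xhat (T :: 'd set)))"
  define N where "N = real (CARD('d) choose s)"
  have s: "s \<le> CARD('d)" and "real s = real CARD('d) - real t"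
    using assms(7) by (simp_all add: s_def)
  then have K_eq: "K = 1 + (real CARD('d) - real t) / real CARD('d)"
    by (simp add: K_def)
  have K: "0 < K"
    by (simp add: K_def add_pos_nonneg)
  have N: "0 < N"
    using s by (simp add: N_def zero_less_binomial)
  have m: "1 \<le> m i" and inj: "inj_on (xhat i) {1..m i}" and p1: "(\<Sum>j\<in>{1..m i}. p i j) = 1"
    and lam: "0 \<le> lam i" if "i \<in> {1..k}" for i
    using assms(1,2,4,5) that by blast+
  have p: "0 \<le> p i j" if "i \<in> {1..k}" "j \<in> {1..m i}" for i j
    using assms(3) that by blast
  \<comment> \<open>The family of subsets of size \<open>s\<close> has positive cardinality, so
    \<open>pmf_of_set\<close> is the uniform distribution on it and the expectation is the
    arithmetic mean.\<close>
  have card_subsets: "card {T :: 'd set. card T = s} = CARD('d) choose s"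
    using n_subsets[of "UNIV :: 'd set" s] by simp
  then have "card {T :: 'd set. card T = s} \<noteq> 0"
    using N by (simp add: N_def)
  then have "{T :: 'd set. card T = s} \<noteq> {}"
    by force
  then have avg: "measure_pmf.expectation (pmf_of_set {T :: 'd set. card T = s})
      (\<lambda>T. restricted_value k lam m p xhat (S3 k m xhat T)) = V / N"
    unfolding V_def N_def by (subst integral_pmf_of_set) (simp_all add: card_subsets)
  \<comment> \<open>Dividing by the positive constant \<open>K\<close> turns the claim into a lower
    bound valid for each \<open>P\<close>, which passes to the infimum.\<close>
  have "V / N / K \<le> barycenter_value k lam m p xhat"
    unfolding barycenter_value_def
  proof (rule cINF_greatest[OF P1_measures_nonempty], rule field_le_epsilon)
    fix P :: "(real ^ 'd) measure" and e :: real
    assume P: "P \<in> P1_measures" and e: "0 < e"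
    let ?Q = "\<lambda>i. discrete_measure (m i) (p i) (xhat i)"
    \<comment> \<open>Couplings within \<open>e\<close> of the infimum suffice, so optimal couplings
      need not be produced.\<close>
    define near where "near i R \<longleftrightarrow> R \<in> couplings P (?Q i)
        \<and> (\<integral>z. l1_norm (fst z - snd z) \<partial>R) \<le> W1 P (?Q i) + e" for i R
    have "\<exists>R. near i R" if i: "i \<in> {1..k}" for i
    proof -
      let ?I = "(\<lambda>R. \<integral>z. l1_norm (fst z - snd z) \<partial>R) ` couplings P (?Q i)"
      have "couplings P (?Q i) \<noteq> {}"
        by (intro couplings_nonempty P prob_space_discrete_measure p p1 i sets_discrete_measure)
      then have ne: "?I \<noteq> {}"
        by blast
      have "Inf ?I < W1 P (?Q i) + e"
        unfolding W1_def using e by simp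
      from cInf_lessD[OF ne this] obtain r where r: "r \<in> ?I" "r < W1 P (?Q i) + e"
        by blast
      from r(1) obtain R where "r = (\<integral>z. l1_norm (fst z - snd z) \<partial>R)" "R \<in> couplings P (?Q i)"
        by (rule imageE)
      with r(2) have "near i R"
        unfolding near_def by simp
      then show ?thesis
        by blast
    qed
    then obtain R where near: "\<And>i. i \<in> {1..k} \<Longrightarrow> near i (R i)"
      by metis
    have R: "R i \<in> couplings P (?Q i)"
      and R_le: "(\<integral>z. l1_norm (fst z - snd z) \<partial>R i) \<le> W1 P (?Q i) + e" if "i \<in> {1..k}" for i
      using near[OF that] unfolding near_def by blast+
    have "V \<le> N * K * (\<Sum>i\<in>{1..k}. lam i * (\<integral>z. l1_norm (fst z - snd z) \<partial>R i))"
      unfolding V_def N_def K_def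
      by (rule average_restricted_value_le_couplings[OF m inj p lam assms(6) s P R])
    also have "\<dots> \<le> N * K * (\<Sum>i\<in>{1..k}. lam i * (W1 P (?Q i) + e))"
      using N K by (intro mult_left_mono sum_mono R_le lam) auto
    \<comment> \<open>Because the weights sum to 1, the total excess is exactly
      \<open>e\<close>.\<close>
    also have "(\<Sum>i\<in>{1..k}. lam i * (W1 P (?Q i) + e)) = (\<Sum>i\<in>{1..k}. lam i * W1 P (?Q i)) + e"
      unfolding distrib_left sum.distrib sum_distrib_right[symmetric] assms(6) by simp
    finally show "V / N / K \<le> (\<Sum>i\<in>{1..k}. lam i * W1 P (?Q i)) + e"
      using N K by (simp add: divide_le_eq mult_ac)
  qed
  then have "V / N \<le> K * barycenter_value k lam m p xhat"
    using pos_divide_le_eq[OF K, of "V / N"] by (simp only: mult.commute)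
  then show ?thesis
    unfolding s_def[symmetric] avg K_eq[symmetric] .
qed

end
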